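(* Let $X$ be a compact metric space and let $G$ be a finite subset of $X\times X$ such that $p_1(G)\subseteq p_2(G)$. The following statements are equivalent. (1) $\mathrm{ent}(G)\neq 0$. (2) There are a set $A\subseteq X$, a positive integer $k\geq 2$, and an $\varepsilon>0$ such that $G$ has a $(k,\varepsilon)$-return on $A$. (3) There are positive integers $k_x$ and $k_y$ with $k_x,k_y>1$, points $\mathbf x\in\star_{i=1}^{k_x-1}G^{-1}$ and $\mathbf y\in\star_{i=1}^{k_y-1}G^{-1}$ such that $\pi_{k_x}(\mathbf x)=\pi_1(\mathbf x)=\pi_1(\mathbf y)=\pi_{k_y}(\mathbf y)$, and a positive integer $j$ such that $1<j\leq\min\{k_x,k_y\}$ and $\pi_j(\mathbf x)\neq\pi_j(\mathbf y)$. (4) $\star_{i=1}^{\infty}G^{-1}$ is uncountable.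
   Context: $\rho$ denotes the metric on $X$. $p_1,p_2:X\times X\to X$ are the projections $p_1(s,t)=s$, $p_2(s,t)=t$. $\pi_k$ denotes the projection of a finite or infinite sequence of points of $X$ to its $k$-th coordinate. A closed relation on $X$ is a closed subset of $X\times X$ (a finite subset is a closed relation). Mahavier products: for each positive integer $m$, $$\star_{i=1}^{m}G^{-1}=\{(x_1,\ldots,x_{m+1})\in X^{m+1} : (x_{i+1},x_i)\in G \text{ for each } i\in\{1,\ldots,m\}\},$$ and $$\star_{i=1}^{\infty}G^{-1}=\{(x_1,x_2,x_3,\ldots)\in \prod_{i=1}^{\infty}X : (x_{i+1},x_i)\in G \text{ for each positive integer } i\}.$$ Returns: let $A$ be a non-empty subset of $X$, $k\ge 2$ an integer and $\varepsilon>0$. $G$ has a $(k,\varepsilon)$-return on $A$ if for each $a\in A$ there are integers $j,j'$ with $1<j'\leq j\leq k$ and points $(x_1,\ldots,x_j),(y_1,\ldots,y_j)\in \star_{i=1}^{j-1}G^{-1}$ such that (1) $a=x_1=y_1$, (2) $\{x_j,y_j\}\subseteq A$, (3) $\rho(x_{j'},y_{j'})>\varepsilon$. (In particular, having a $(k,\varepsilon)$-return on $A$ includes that $A$ is non-empty.) Entropy: for a non-empty open cover $\alpha$ of $X$ and a positive integer $n$ let $\alpha^{n}=\{S_1\times\cdots\times S_n : S_1,\ldots,S_n\in\alpha\}$. For a closed $K\subseteq X^n$ and a non-empty family $\mathcal U$ of open subsets of $X^n$ covering $K$, $N(K,\mathcal U)$ is the minimal cardinality of a non-empty subfamily of $\mathcal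 U$ that covers $K$. Define $\mathrm{ent}(G,\alpha)=\lim_{m\to\infty}\frac{\log N(\star_{i=1}^{m}G^{-1},\alpha^{m+1})}{m}$ (this limit is known to exist), and $\mathrm{ent}(G)=\sup_\alpha \mathrm{ent}(G,\alpha)\in[0,\infty]$, the supremum over all non-empty open covers $\alpha$ of $X$ (equal to $\infty$ if the set of values is unbounded). In particular $\mathrm{ent}(\emptyset)=0$. *)

theory Defs
  imports "HOL-Analysis.Analysis"
begin

text \<open>The compact metric space is a compact set \<open>X\<close> in a metric-space type, with metric \<open>dist\<close>.
  Points of \<open>X\<^sup>n\<close> are lists of length \<open>n\<close> with entries in \<open>X\<close>, points of the countable power
  are sequences \<open>nat \<Rightarrow> 'a\<close>. Coordinates are counted from 1 on paper and from 0 here;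
  \<open>coord\<close> restores the 1-based count for lists.\<close>

definition coord :: "nat \<Rightarrow> 'a list \<Rightarrow> 'a" where
  "coord k xs = xs ! (k - 1)"

definition mahavier :: "'a set \<Rightarrow> ('a \<times> 'a) set \<Rightarrow> nat \<Rightarrow> 'a list set" where
  "mahavier X G m =
     {xs. length xs = m + 1 \<and> set xs \<subseteq> X \<and>
          (\<forall>i\<in>{1..m}. (coord (i + 1) xs, coord i xs) \<in> G)}"

definition mahavier_inf :: "'a set \<Rightarrow> ('a \<times> 'a) set \<Rightarrow> (nat \<Rightarrow> 'a) set" where
  "mahavier_inf X G = {x. range x \<subseteq> X \<and> (\<forall>i. (x (Suc i), x i) \<in> G)}"

definition has_return ::
    "'a::metric_space set \<Rightarrow> ('a \<times> 'a) set \<Rightarrow> nat \<Rightarrow> real \<Rightarrow> 'a set \<Rightarrow> bool" where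
  "has_return X G k \<epsilon> A \<longleftrightarrow>
     A \<noteq> {} \<and>
     (\<forall>a\<in>A. \<exists>j j'. 1 < j' \<and> j' \<le> j \<and> j \<le> k \<and>
        (\<exists>x\<in>mahavier X G (j - 1). \<exists>y\<in>mahavier X G (j - 1).
           coord 1 x = a \<and> coord 1 y = a \<and>
           {coord j x, coord j y} \<subseteq> A \<and>
           dist (coord j' x) (coord j' y) > \<epsilon>))"

definition open_cover :: "'a::topological_space set \<Rightarrow> 'a set set \<Rightarrow> bool" where
  "open_cover X \<alpha> \<longleftrightarrow>
     \<alpha> \<noteq> {} \<and> (\<forall>S\<in>\<alpha>. openin (top_of_set X) S) \<and> X \<subseteq> \<Union>\<alpha>"

definition cover_power :: "'a set set \<Rightarrow> nat \<Rightarrow> 'a list set set" where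
  "cover_power \<alpha> n = listset ` {Ss. length Ss = n \<and> set Ss \<subseteq> \<alpha>}"

text \<open>Only finite subfamilies compete: \<open>card\<close> of an infinite family is 0. In the intended use
  \<open>K\<close> is compact and \<open>\<U>\<close> an open cover of it, so that a finite subcover exists. The subfamily
  has to be non-empty, hence the value is 1, not 0, for \<open>K = {}\<close>.\<close>

definition cover_number :: "'b set \<Rightarrow> 'b set set \<Rightarrow> nat" where
  "cover_number K \<U> =
     (LEAST n. \<exists>\<V>. \<V> \<subseteq> \<U> \<and> \<V> \<noteq> {} \<and> finite \<V> \<and> K \<subseteq> \<Union>\<V> \<and> card \<V> = n)"

definition ent_cover ::
    "'a set \<Rightarrow> ('a \<times> 'a) set \<Rightarrow> 'a set set \<Rightarrow> real" where
  "ent_cover X G \<alpha> =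
     lim (\<lambda>m. ln (real (cover_number (mahavier X G m) (cover_power \<alpha> (m + 1)))) / real m)"

definition ent :: "'a::topological_space set \<Rightarrow> ('a \<times> 'a) set \<Rightarrow> ereal" where
  "ent X G = (SUP \<alpha>\<in>{\<alpha>. open_cover X \<alpha>}. ereal (ent_cover X G \<alpha>))"

end

theory Submission
  imports Defs "HOL-Real_Asymp.Real_Asymp"
begin

text \<open>Read \<open>G\<close> as a finite directed graph with an edge from \<open>x\<close> to \<open>y\<close> whenever \<open>(y, x) \<in> G\<close>.
  The Mahavier products are then the sets of finite and of infinite walks, and \<open>Field G\<close> is
  the set of vertices. Each of the four statements is shown to be equivalent to one
  property of this graph, \<open>diverging_loops G\<close>: there are two closed walks at a common vertex,
  neither of which is an initial segment of the other.

  Suppose there are diverging loops. Repeating each as often as the other is long makes their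
  lengths equal, say to \<open>L\<close>, and the resulting loops \<open>u\<close>, \<open>v\<close> at \<open>a\<close> still differ somewhere.
  They witness a return on \<open>{a}\<close>. Any sequence of choices between \<open>u\<close> and \<open>v\<close>
  can be strung together into a walk, and different choices give different walks. Hence
  there are uncountably many infinite walks, and at least \<open>2 ^ n\<close> walks of length \<open>n * L\<close>. Finitely
  many points can be separated by an open cover each of whose members contains only one vertex;
  for that cover the cover number is the number of walks, and the entropy is at least
  \<open>ln 2 / L\<close> (\<open>diverging_loops_imp_ent_pos\<close>). That the defining limit exists is Fekete's lemma
  (\<open>subadditive_quotient_convergent\<close>).

  Suppose there are no diverging loops. Between two visits to a vertex \<open>v\<close> a walk is a closed
  walk at \<open>v\<close>, and its course is forced by the absence of diverging loops. So a
  walk is determined by the times of its first and last visit to each of the finitely many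
  vertices (\<open>visit_spans_determine_walk\<close>). There are countably many such data for infinite walks
  and only polynomially many, in \<open>m\<close>, for walks of length \<open>m\<close>. The number of walks bounds
  the cover number of every open cover, so the entropy vanishes.

  A return on some set \<open>A\<close> gives diverging loops as follows. All points of \<open>A\<close> are vertices, so
  \<open>A\<close> is finite and has a point \<open>a\<close> that can be reached again from every point of \<open>A\<close>
  that it reaches. The two walks that the return provides at \<open>a\<close> end in \<open>A\<close> and can
  therefore be completed to closed walks, which still differ
  (\<open>has_return_imp_diverging_loops\<close>).\<close>

section \<open>Walks and loops\<close>

text \<open>Steps follow the edges of \<open>G\<inverse>\<close>, as in the Mahavier product. A walk of length \<open>n\<close> is a
  total function of which only the values at \<open>0, \<dots>, n\<close> matter, so that finite and
  infinite walks, shifts and concatenations can be treated alike.\<close>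

definition walk :: "('a \<times> 'a) set \<Rightarrow> (nat \<Rightarrow> 'a) \<Rightarrow> nat \<Rightarrow> bool" where
  "walk G w n \<longleftrightarrow> (\<forall>i<n. (w (Suc i), w i) \<in> G)"

text \<open>Replaces the count from 1 in the coordinates by the count from 0.\<close>

lemma mahavier_iff_walk:
  "xs \<in> mahavier X G m \<longleftrightarrow> length xs = Suc m \<and> set xs \<subseteq> X \<and> walk G ((!) xs) m"
proof -
  have "(\<forall>i\<in>{1..m}. (coord (i + 1) xs, coord i xs) \<in> G) \<longleftrightarrow> walk G ((!) xs) m"
    (is "?L \<longleftrightarrow> ?R")
  proof
    assume L: ?L
    show ?R unfolding walk_def
    proof (intro allI impI)
      fix i assume "i < m"
      then have "Suc i \<in> {1..m}" by simp
      with L have "(coord (Suc i + 1) xs, coord (Suc i) xs) \<in> G" by blast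
      then show "(xs ! Suc i, xs ! i) \<in> G" by (simp add: coord_def)
    qed
  next
    assume R: ?R
    show ?L
    proof
      fix i assume "i \<in> {1..m}"
      then obtain k where "i = Suc k" "k < m" by (cases i) auto
      with R show "(coord (i + 1) xs, coord i xs) \<in> G" by (simp add: coord_def walk_def)
    qed
  qed
  then show ?thesis by (simp add: mahavier_def)
qed

lemma walk_in_Field:
  assumes "walk G w n" "0 < n" "i \<le> n"
  shows "w i \<in> Field G"
proof (cases "i < n")
  case True
  with assms(1) show ?thesis by (auto simp: walk_def intro: FieldI2)
next
  case False
  with assms obtain k where "i = Suc k" "k < n" by (cases i) auto
  with assms(1) show ?thesis by (auto simp: walk_def intro: FieldI1)
qed

lemma walk_mono: "walk G w n \<Longrightarrow> m \<le> n \<Longrightarrow> walk G w m"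
  by (simp add: walk_def)

lemma walk_cong: "(\<And>i. i \<le> n \<Longrightarrow> w i = w' i) \<Longrightarrow> walk G w n \<longleftrightarrow> walk G w' n"
  by (auto simp: walk_def)

lemma walk_shift: "walk G w t \<Longrightarrow> walk G (\<lambda>k. w (s + k)) (t - s)"
  by (auto simp: walk_def)

lemma walk_append:
  assumes "walk G w m" "walk G w' n" "w m = w' 0"
  shows "walk G (\<lambda>i. if i \<le> m then w i else w' (i - m)) (m + n)"
  unfolding walk_def
proof (intro allI impI)
  fix i assume "i < m + n"
  consider "i < m" | "i = m" | "i > m" by linarith
  then show "(if Suc i \<le> m then w (Suc i) else w' (Suc i - m), if i \<le> m then w i else w' (i - m)) \<in> G"
  proof cases
    case 1 then show ?thesis using assms(1) by (simp add: walk_def)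
  next
    case 2
    then have "0 < n" using \<open>i < m + n\<close> by simp
    then have "(w' (Suc 0), w' 0) \<in> G" using assms(2) by (simp add: walk_def)
    then show ?thesis using 2 assms(3) by simp
  next
    case 3
    then have "i - m < n" "Suc i - m = Suc (i - m)" using \<open>i < m + n\<close> by auto
    then show ?thesis using 3 assms(2) by (simp add: walk_def)
  qed
qed

lemma walk_to_list:
  assumes "walk G w m" "0 < m" "Field G \<subseteq> X"
  shows "map w [0..<Suc m] \<in> mahavier X G m"
proof -
  have "set (map w [0..<Suc m]) \<subseteq> X"
    using walk_in_Field[OF assms(1,2)] assms(3) by auto
  moreover have "walk G ((!) (map w [0..<Suc m])) m"
    using assms(1) by (subst walk_cong[where w' = w]) (auto simp del: upt_Suc)
  ultimately show ?thesis by (simp add: mahavier_iff_walk)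
qed

lemma reachable_imp_walk:
  assumes "(a, b) \<in> (G\<inverse>)\<^sup>*"
  shows "\<exists>w n. walk G w n \<and> w 0 = a \<and> w n = b"
  using assms
proof (induction rule: rtrancl_induct)
  case base
  have "walk G (\<lambda>_. a) 0" by (simp add: walk_def)
  then show ?case by blast
next
  case (step b c)
  then obtain w n where w: "walk G w n" "w 0 = a" "w n = b" by blast
  have "walk G (w(Suc n := c)) (Suc n)" "(w(Suc n := c)) 0 = a" "(w(Suc n := c)) (Suc n) = c"
    using w step.hyps by (auto simp: walk_def less_Suc_eq)
  then show ?case by blast
qed

lemma walk_imp_reachable:
  assumes "walk G w n"
  shows "(w 0, w n) \<in> (G\<inverse>)\<^sup>*"
  using assms
proof (induction n)
  case (Suc n)
  then have "(w 0, w n) \<in> (G\<inverse>)\<^sup>*" "(w n, w (Suc n)) \<in> G\<inverse>" by (auto simp: walk_def)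
  then show ?case by (rule rtrancl_into_rtrancl)
qed simp

text \<open>Loops of one length \<open>L\<close> at one vertex can be traversed one after the other in any order: at each
  multiple of \<open>L\<close> the end of one loop is the start of the next.\<close>

lemma walk_concat_loops:
  assumes "L > 0" and "\<And>t. walk G (c t) L" and "\<And>t. c t 0 = a" "\<And>t. c t L = a"
  shows "walk G (\<lambda>i. c (i div L) (i mod L)) n"
  unfolding walk_def
proof (intro allI impI)
  fix i :: nat
  have step: "(c (i div L) (Suc (i mod L)), c (i div L) (i mod L)) \<in> G"
    using assms(1,2) by (simp add: walk_def)
  show "(c (Suc i div L) (Suc i mod L), c (i div L) (i mod L)) \<in> G"
  proof (cases "Suc (i mod L) = L")
    case True
    then have "Suc i mod L = 0" by (simp add: mod_Suc)
    then show ?thesis using step True assms(3,4) by metis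
  next
    case False
    then have "Suc i mod L = Suc (i mod L)" "Suc i div L = i div L"
      by (auto simp: mod_Suc div_Suc)
    then show ?thesis using step by simp
  qed
qed

text \<open>The third statement of the theorem, freed of lists and of the count from 1. Since both walks
  start at the same point, \<open>j > 0\<close> and hence \<open>p, q > 0\<close> hold automatically.\<close>

definition diverging_loops :: "('a \<times> 'a) set \<Rightarrow> bool" where
  "diverging_loops G \<longleftrightarrow>
     (\<exists>u v p q j. walk G u p \<and> walk G v q \<and> u p = u 0 \<and> v 0 = u 0 \<and> v q = u 0 \<and>
        j \<le> p \<and> j \<le> q \<and> u j \<noteq> v j)"

text \<open>Run the first loop \<open>q\<close> times and the second \<open>p\<close> times, where \<open>p\<close> and \<open>q\<close> are their lengths. The position
  \<open>j\<close> at which they differ lies in the first round of both, so the repeated loops differ there too.\<close>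

lemma diverging_loops_equal_length:
  assumes "diverging_loops G"
  obtains u v L j where "walk G u L" "walk G v L" "u L = u 0" "v 0 = u 0" "v L = u 0"
    "0 < j" "j < L" "u j \<noteq> v j"
proof -
  obtain u v p q j where uv: "walk G u p" "walk G v q" "u p = u 0" "v 0 = u 0" "v q = u 0"
    "j \<le> p" "j \<le> q" "u j \<noteq> v j"
    using assms unfolding diverging_loops_def by blast
  have "j > 0" using uv by (metis gr0I)
  then have pq: "p > 0" "q > 0" using uv by auto
  let ?u = "\<lambda>i. u (i mod p)" and ?v = "\<lambda>i. v (i mod q)"
  have u: "?u i = u i" if "i \<le> p" for i
    using that uv by (cases "i = p") auto
  have v: "?v i = v i" if "i \<le> q" for i
    using that uv by (cases "i = q") auto
  have ne: "?u j \<noteq> ?v j" using u v uv by simp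
  \<comment> \<open>Both repeated loops are back at their start at time \<open>p * q\<close>, so \<open>j\<close> is strictly smaller.\<close>
  have "?u (p * q) = ?v (p * q)" using uv by simp
  then have "j \<noteq> p * q" using ne by auto
  moreover have "j \<le> p * q" using uv(6) mult_le_mono2[of 1 q p] pq(2) by linarith
  ultimately have "j < p * q" by simp
  show thesis
  proof (rule that[of ?u "p * q" ?v j])
    show "walk G ?u (p * q)" "walk G ?v (p * q)"
      using walk_concat_loops[of p G "\<lambda>_. u" "u 0"] walk_concat_loops[of q G "\<lambda>_. v" "u 0"] uv pq
      by auto
  qed (use uv pq \<open>j > 0\<close> \<open>j < p * q\<close> ne in auto)
qed

section \<open>Returns\<close>

lemma has_return_iff_walk:
  assumes "Field G \<subseteq> X"
  shows "has_return X G k \<epsilon> A \<longleftrightarrow>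
     A \<noteq> {} \<and> (\<forall>a\<in>A. \<exists>n i u v. 0 < i \<and> i \<le> n \<and> n < k \<and> walk G u n \<and> walk G v n \<and>
        u 0 = a \<and> v 0 = a \<and> {u n, v n} \<subseteq> A \<and> dist (u i) (v i) > \<epsilon>)"
proof -
  have "(\<exists>j j'. 1 < j' \<and> j' \<le> j \<and> j \<le> k \<and>
        (\<exists>x\<in>mahavier X G (j - 1). \<exists>y\<in>mahavier X G (j - 1).
           coord 1 x = a \<and> coord 1 y = a \<and>
           {coord j x, coord j y} \<subseteq> A \<and> dist (coord j' x) (coord j' y) > \<epsilon>)) \<longleftrightarrow>
     (\<exists>n i u v. 0 < i \<and> i \<le> n \<and> n < k \<and> walk G u n \<and> walk G v n \<and>
        u 0 = a \<and> v 0 = a \<and> {u n, v n} \<subseteq> A \<and> dist (u i) (v i) > \<epsilon>)"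
    (is "?L \<longleftrightarrow> ?R") for a
  proof
    assume ?L
    then obtain j j' x y where *: "1 < j'" "j' \<le> j" "j \<le> k"
      "x \<in> mahavier X G (j - 1)" "y \<in> mahavier X G (j - 1)"
      "coord 1 x = a" "coord 1 y = a" "{coord j x, coord j y} \<subseteq> A"
      "dist (coord j' x) (coord j' y) > \<epsilon>" by blast
    show ?R
      by (rule exI[of _ "j - 1"], rule exI[of _ "j' - 1"], rule exI[of _ "(!) x"],
          rule exI[of _ "(!) y"]) (use * in \<open>auto simp: coord_def mahavier_iff_walk\<close>)
  next
    assume ?R
    then obtain n i u v where *: "0 < i" "i \<le> n" "n < k" "walk G u n" "walk G v n"
        "u 0 = a" "v 0 = a" "{u n, v n} \<subseteq> A" "dist (u i) (v i) > \<epsilon>" by blast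
    have co: "coord (Suc r) (map w [0..<Suc n]) = w r" if "r \<le> n" for r and w :: "nat \<Rightarrow> 'a"
      using that by (auto simp: coord_def simp del: upt_Suc)
    show ?L
    proof (rule exI[of _ "Suc n"], rule exI[of _ "Suc i"], intro conjI)
      show "\<exists>x\<in>mahavier X G (Suc n - 1). \<exists>y\<in>mahavier X G (Suc n - 1).
           coord 1 x = a \<and> coord 1 y = a \<and>
           {coord (Suc n) x, coord (Suc n) y} \<subseteq> A \<and> dist (coord (Suc i) x) (coord (Suc i) y) > \<epsilon>"
        using walk_to_list[OF *(4) _ assms] walk_to_list[OF *(5) _ assms] co *
        by (intro bexI[of _ "map u [0..<Suc n]"] bexI[of _ "map v [0..<Suc n]"])
           (auto simp del: upt_Suc simp flip: One_nat_def simp: co[of 0, simplified])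
    qed (use * in auto)
  qed
  then show ?thesis by (simp add: has_return_def)
qed

lemma diverging_loops_imp_has_return:
  fixes X :: "'a::metric_space set"
  assumes "diverging_loops G" "Field G \<subseteq> X"
  shows "\<exists>A k \<epsilon>. A \<subseteq> X \<and> k \<ge> 2 \<and> \<epsilon> > 0 \<and> has_return X G k \<epsilon> A"
proof -
  obtain u v L j where uv: "walk G u L" "walk G v L" "u L = u 0" "v 0 = u 0" "v L = u 0"
    "0 < j" "j < L" "u j \<noteq> v j"
    using diverging_loops_equal_length[OF assms(1)] .
  have "u 0 \<in> X" using walk_in_Field[OF uv(1), of 0] uv assms(2) by auto
  moreover have "has_return X G (Suc L) (dist (u j) (v j) / 2) {u 0}"
    unfolding has_return_iff_walk[OF assms(2)] using uv
    by simp (rule exI[of _ L], rule exI[of _ j], simp, rule exI[of _ u], simp, rule exI[of _ v], simp)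
  ultimately show ?thesis using uv
    by (intro exI[of _ "{u 0}"] exI[of _ "Suc L"] exI[of _ "dist (u j) (v j) / 2"]) auto
qed

text \<open>A walk out of a point of \<open>A\<close> into \<open>A\<close> becomes a closed walk once its end can reach its start. This
  is guaranteed for a start \<open>a\<close> from which as few points of \<open>A\<close> as possible are reachable:
  from \<open>b \<in> A\<close> reachable from \<open>a\<close> one reaches no more points than from \<open>a\<close>, hence by minimality the same
  ones, and \<open>a\<close> is among them.\<close>

lemma has_return_imp_diverging_loops:
  fixes X :: "'a::metric_space set"
  assumes "has_return X G k \<epsilon> A" "\<epsilon> > 0" "finite G" "Field G \<subseteq> X"
  shows "diverging_loops G"
proof -
  have "A \<noteq> {}" and ret: "\<And>a. a \<in> A \<Longrightarrow> \<exists>n i u v. 0 < i \<and> i \<le> n \<and> n < k \<and> walk G u n \<and>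
      walk G v n \<and> u 0 = a \<and> v 0 = a \<and> {u n, v n} \<subseteq> A \<and> dist (u i) (v i) > \<epsilon>"
    using assms(1) unfolding has_return_iff_walk[OF assms(4)] by auto
  have "A \<subseteq> Field G"
  proof
    fix a assume "a \<in> A"
    from ret[OF this] obtain n u where "walk G u n" "n > 0" "u 0 = a" by force
    then show "a \<in> Field G" using walk_in_Field[of G u n 0] by simp
  qed
  then have "finite A" using assms(3) by (meson finite_Field finite_subset)
  define R where "R a = {b\<in>A. (a, b) \<in> (G\<inverse>)\<^sup>*}" for a
  have finR: "finite (R a)" for a using \<open>finite A\<close> by (simp add: R_def)
  obtain a where a: "a \<in> A" "\<And>b. b \<in> A \<Longrightarrow> card (R a) \<le> card (R b)"
    using \<open>A \<noteq> {}\<close> ex_has_least_nat[of "\<lambda>a. a \<in> A" _ "\<lambda>a. card (R a)"] by blast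
  have returns: "(b, a) \<in> (G\<inverse>)\<^sup>*" if "b \<in> A" "(a, b) \<in> (G\<inverse>)\<^sup>*" for b
  proof -
    have "R b \<subseteq> R a" using that by (auto simp: R_def)
    then have "R b = R a" using a(2)[OF that(1)] finR card_seteq by blast
    moreover have "a \<in> R a" using a by (simp add: R_def)
    ultimately have "a \<in> R b" by simp
    then show ?thesis by (simp add: R_def)
  qed
  obtain n i u v where uv: "0 < i" "i \<le> n" "walk G u n" "walk G v n" "u 0 = a" "v 0 = a"
    "u n \<in> A" "v n \<in> A" "dist (u i) (v i) > \<epsilon>"
    using ret[OF a(1)] by auto
  have close: "\<exists>w' l. walk G w' l \<and> (\<forall>r\<le>n. w' r = w r) \<and> w' l = a \<and> n \<le> l"
    if w: "walk G w n" "w 0 = a" "w n \<in> A" for w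
  proof -
    have "(w n, a) \<in> (G\<inverse>)\<^sup>*" using returns[OF w(3)] walk_imp_reachable[OF w(1)] w(2) by simp
    then obtain z l where z: "walk G z l" "z 0 = w n" "z l = a" using reachable_imp_walk by metis
    show ?thesis
    proof (intro exI conjI)
      show "walk G (\<lambda>i. if i \<le> n then w i else z (i - n)) (n + l)"
        using walk_append[OF w(1) z(1)] z by simp
    qed (use z in auto)
  qed
  obtain u' p where u': "walk G u' p" "\<forall>r\<le>n. u' r = u r" "u' p = a" "n \<le> p"
    using close[OF uv(3,5,7)] by blast
  obtain v' q where v': "walk G v' q" "\<forall>r\<le>n. v' r = v r" "v' q = a" "n \<le> q"
    using close[OF uv(4,6,8)] by blast
  have "u i \<noteq> v i" using uv(9) assms(2) by auto
  then show ?thesis unfolding diverging_loops_def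
    using u' v' uv by (intro exI[of _ u'] exI[of _ v'] exI[of _ p] exI[of _ q] exI[of _ i]) auto
qed

lemma diverging_loops_iff_mahavier:
  fixes X :: "'a set"
  assumes "Field G \<subseteq> X"
  shows "diverging_loops G \<longleftrightarrow> (\<exists>kx ky. kx > 1 \<and> ky > 1 \<and>
     (\<exists>x\<in>mahavier X G (kx - 1). \<exists>y\<in>mahavier X G (ky - 1).
        coord kx x = coord 1 x \<and> coord 1 x = coord 1 y \<and> coord 1 y = coord ky y \<and>
        (\<exists>j. 1 < j \<and> j \<le> min kx ky \<and> coord j x \<noteq> coord j y)))" (is "_ \<longleftrightarrow> ?R")
proof
  assume "diverging_loops G"
  then obtain u v L j where uv: "walk G u L" "walk G v L" "u L = u 0" "v 0 = u 0" "v L = u 0"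
    "0 < j" "j < L" "u j \<noteq> v j"
    using diverging_loops_equal_length by metis
  have co: "coord (Suc r) (map w [0..<Suc L]) = w r" if "r \<le> L" for r and w :: "nat \<Rightarrow> 'a"
    using that by (auto simp: coord_def simp del: upt_Suc)
  have "L > 0" using uv by simp
  then have mem: "map u [0..<Suc L] \<in> mahavier X G (Suc L - 1)"
    "map v [0..<Suc L] \<in> mahavier X G (Suc L - 1)"
    using walk_to_list[OF uv(1) _ assms] walk_to_list[OF uv(2) _ assms] by simp_all
  have one: "(1::nat) = Suc 0" by simp
  show ?R
    by (rule exI[of _ "Suc L"], rule exI[of _ "Suc L"], intro conjI bexI[OF _ mem(1)] bexI[OF _ mem(2)]
          exI[of _ "Suc j"]; (unfold one)?; (subst co)?; (subst co)?) (use uv \<open>L > 0\<close> in auto)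
next
  assume ?R
  then obtain kx ky x y j where *: "kx > 1" "ky > 1" "x \<in> mahavier X G (kx - 1)"
    "y \<in> mahavier X G (ky - 1)" "coord kx x = coord 1 x" "coord 1 x = coord 1 y"
    "coord 1 y = coord ky y" "1 < j" "j \<le> min kx ky" "coord j x \<noteq> coord j y" by blast
  show "diverging_loops G" unfolding diverging_loops_def
    by (rule exI[of _ "(!) x"], rule exI[of _ "(!) y"], rule exI[of _ "kx - 1"],
        rule exI[of _ "ky - 1"], rule exI[of _ "j - 1"])
       (use * in \<open>auto simp: coord_def mahavier_iff_walk\<close>)
qed

section \<open>Many walks when loops diverge\<close>

definition splice_loops :: "(nat \<Rightarrow> 'a) \<Rightarrow> (nat \<Rightarrow> 'a) \<Rightarrow> nat \<Rightarrow> (nat \<Rightarrow> bool) \<Rightarrow> nat \<Rightarrow> 'a" where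
  "splice_loops u v L b i = (if b (i div L) then u else v) (i mod L)"

lemma walk_splice_loops:
  assumes "walk G u L" "walk G v L" "u L = u 0" "v 0 = u 0" "v L = u 0" "0 < L"
  shows "walk G (splice_loops u v L b) n"
  using walk_concat_loops[of L G "\<lambda>t. if b t then u else v" "u 0" n] assms
  unfolding splice_loops_def by auto

lemma splice_loops_at:
  assumes "j < L"
  shows "splice_loops u v L b (t * L + j) = (if b t then u j else v j)"
proof -
  have "(t * L + j) div L = t" "(t * L + j) mod L = j" using assms by auto
  then show ?thesis by (simp add: splice_loops_def)
qed

text \<open>Cantor's diagonal argument.\<close>

lemma uncountable_bool_sequences: "uncountable (UNIV :: (nat \<Rightarrow> bool) set)"
proof
  assume "countable (UNIV :: (nat \<Rightarrow> bool) set)"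
  then obtain f :: "nat \<Rightarrow> nat \<Rightarrow> bool" where "range f = UNIV"
    using uncountable_def[of "UNIV :: (nat \<Rightarrow> bool) set"] by auto
  then obtain n where "f n = (\<lambda>k. \<not> f k k)" by (metis UNIV_I rangeE)
  then show False by metis
qed

lemma diverging_loops_imp_uncountable:
  fixes X :: "'a set"
  assumes "diverging_loops G" "Field G \<subseteq> X"
  shows "uncountable (mahavier_inf X G)"
proof
  assume c: "countable (mahavier_inf X G)"
  obtain u v L j where uv: "walk G u L" "walk G v L" "u L = u 0" "v 0 = u 0" "v L = u 0"
    "0 < j" "j < L" "u j \<noteq> v j"
    using diverging_loops_equal_length[OF assms(1)] .
  have w: "walk G (splice_loops u v L b) n" for b n
    using walk_splice_loops[OF uv(1-5)] uv by simp
  have "range (splice_loops u v L) \<subseteq> mahavier_inf X G"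
  proof
    fix s assume "s \<in> range (splice_loops u v L)"
    then have s: "walk G s n" for n using w by auto
    then have "s i \<in> X" "(s (Suc i), s i) \<in> G" for i
      using walk_in_Field[OF s, of "Suc i" i] assms(2) s[of "Suc i"] by (auto simp: walk_def)
    then show "s \<in> mahavier_inf X G" by (auto simp: mahavier_inf_def)
  qed
  then have "countable (range (splice_loops u v L))" using c countable_subset by blast
  moreover have "inj (splice_loops u v L)"
  proof (rule injI, rule ext)
    fix b b' t assume "splice_loops u v L b = splice_loops u v L b'"
    then have "splice_loops u v L b (t * L + j) = splice_loops u v L b' (t * L + j)" by simp
    then show "b t = b' t" using uv by (auto simp: splice_loops_at split: if_splits)
  qed
  ultimately have "countable (UNIV :: (nat \<Rightarrow> bool) set)" using countable_image_inj_on by blast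
  then show False using uncountable_bool_sequences by blast
qed

lemma finite_mahavier: "finite X \<Longrightarrow> finite (mahavier X G m)"
  by (rule finite_subset[OF _ finite_lists_length_eq[of X "Suc m"]]) (auto simp: mahavier_def)

text \<open>Each list of \<open>n\<close> bits yields a splice of \<open>n\<close> rounds, and its bit \<open>t\<close> can be read off at time
  \<open>t * L + j\<close>.\<close>

lemma exponentially_many_walks:
  assumes "finite G" "walk G u L" "walk G v L" "u L = u 0" "v 0 = u 0" "v L = u 0"
    "j < L" "u j \<noteq> v j" "0 < n"
  shows "2 ^ n \<le> card (mahavier (Field G) G (n * L))"
proof -
  let ?B = "{bs :: bool list. set bs \<subseteq> UNIV \<and> length bs = n}"
  let ?f = "\<lambda>bs. map (splice_loops u v L ((!) bs)) [0..<Suc (n * L)]"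
  have "L > 0" using assms by simp
  have "?f bs \<in> mahavier (Field G) G (n * L)" for bs
    by (rule walk_to_list[OF walk_splice_loops[OF assms(2-6) \<open>L > 0\<close>]])
       (use \<open>L > 0\<close> assms(9) in auto)
  then have "?f ` ?B \<subseteq> mahavier (Field G) G (n * L)" by blast
  moreover have "inj_on ?f ?B"
  proof (rule inj_onI)
    fix bs cs assume bc: "bs \<in> ?B" "cs \<in> ?B" "?f bs = ?f cs"
    show "bs = cs"
    proof (rule nth_equalityI)
      fix t assume "t < length bs"
      then have "Suc t * L \<le> n * L" using bc by (intro mult_right_mono) auto
      then have "t * L + j < Suc (n * L)" using assms(7) by simp
      then have "?f bs ! (t * L + j) = splice_loops u v L ((!) bs) (t * L + j)"
        "?f cs ! (t * L + j) = splice_loops u v L ((!) cs) (t * L + j)"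
        by (simp_all del: upt_Suc)
      then show "bs ! t = cs ! t" using bc(3) assms(7,8)
        by (simp add: splice_loops_at split: if_splits del: upt_Suc)
    qed (use bc in simp)
  qed
  ultimately have "card ?B \<le> card (mahavier (Field G) G (n * L))"
    using assms(1) by (intro card_inj_on_le finite_mahavier finite_Field)
  moreover have "card ?B = 2 ^ n" by (subst card_lists_length_eq) auto
  ultimately show ?thesis by simp
qed

section \<open>Few walks when loops do not diverge\<close>

text \<open>Applied to the set of times at which a walk visits a given vertex, this records
  whether there is a visit, the time of the first one, and the time of the last one unless there
  are infinitely many.\<close>

definition visit_span :: "nat set \<Rightarrow> (nat \<times> nat option) option" where
  "visit_span S =
     (if S = {} then None else Some (Inf S, if finite S then Some (Max S) else None))"

text \<open>Sets of equal span have a common first element. For the upper bounds \<open>t\<close>, \<open>t'\<close> the common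
  last element serves if there is one; otherwise both sets are unbounded, and the bounds may differ.\<close>

lemma visit_span_eq_imp_enclosed:
  assumes "visit_span S = visit_span S'" "i \<in> S"
  shows "\<exists>s t t'. s \<in> S \<and> s \<in> S' \<and> t \<in> S \<and> t' \<in> S' \<and> s \<le> i \<and> i \<le> t \<and> i \<le> t'"
proof -
  have ne: "S \<noteq> {}" "S' \<noteq> {}" using assms by (auto simp: visit_span_def split: if_splits)
  then have Inf: "Inf S = Inf S'" and fin: "finite S = finite S'"
    and Max: "finite S \<Longrightarrow> Max S = Max S'"
    using assms(1) by (auto simp: visit_span_def split: if_splits)
  have s: "Inf S \<in> S" "Inf S \<in> S'" "Inf S \<le> i"
    using Inf_nat_def1[OF ne(1)] Inf_nat_def1[OF ne(2)] Inf cInf_lower[OF assms(2)] by auto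
  show ?thesis
  proof (cases "finite S")
    case True
    then have "Max S \<in> S" "Max S \<in> S'" "i \<le> Max S"
      using Max_in[OF True ne(1)] Max_in[of S'] Max_ge[OF True assms(2)] ne(2) fin Max[OF True] by auto
    with s show ?thesis by blast
  next
    case False
    then obtain t t' where "t \<in> S" "t' \<in> S'" "i \<le> t" "i \<le> t'"
      using fin infinite_nat_iff_unbounded_le by metis
    with s show ?thesis by blast
  qed
qed

text \<open>Let both walks visit the vertex \<open>w i\<close> first at time \<open>s\<close>, and again at times \<open>t\<close> and \<open>t'\<close> not before \<open>i\<close>.
  From \<open>s\<close> on they are closed walks of lengths \<open>t - s\<close> and \<open>t' - s\<close>, and would diverge at \<open>i - s\<close> if
  they differed at time \<open>i\<close>. The set \<open>T\<close> of times is \<open>{..m}\<close> for walks of length \<open>m\<close> and \<open>UNIV\<close> for infinite ones.\<close>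

lemma visit_spans_determine_walk:
  assumes nd: "\<not> diverging_loops G"
    and w: "\<And>t. t \<in> T \<Longrightarrow> walk G w t" and w': "\<And>t. t \<in> T \<Longrightarrow> walk G w' t"
    and span: "visit_span {t\<in>T. w t = w i} = visit_span {t\<in>T. w' t = w i}"
    and i: "i \<in> T"
  shows "w i = w' i"
proof (rule ccontr)
  assume ne: "w i \<noteq> w' i"
  obtain s t t' where st: "s \<in> T" "t \<in> T" "t' \<in> T" "w s = w i" "w' s = w i" "w t = w i" "w' t' = w i"
    "s \<le> i" "i \<le> t" "i \<le> t'"
    using visit_span_eq_imp_enclosed[OF span, of i] i by auto
  have "diverging_loops G" unfolding diverging_loops_def
  proof (intro exI conjI)
    show "walk G (\<lambda>k. w (s + k)) (t - s)" "walk G (\<lambda>k. w' (s + k)) (t' - s)"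
      using w[OF st(2)] w'[OF st(3)] by (auto intro: walk_shift)
    show "i - s \<le> t - s" "i - s \<le> t' - s" "w (s + (i - s)) \<noteq> w' (s + (i - s))"
      using st ne by auto
  qed (use st in auto)
  then show False using nd by simp
qed

lemma no_diverging_loops_imp_countable:
  fixes X :: "'a set"
  assumes "\<not> diverging_loops G" "finite G"
  shows "countable (mahavier_inf X G)"
proof -
  let ?V = "Field G"
  let ?code = "\<lambda>w. \<lambda>v\<in>?V. visit_span {t\<in>UNIV. w t = v}"
  have w: "walk G w n" if "w \<in> mahavier_inf X G" for w n
    using that by (simp add: mahavier_inf_def walk_def)
  have "inj_on ?code (mahavier_inf X G)"
  proof (rule inj_onI, rule ext)
    fix x y i assume xy: "x \<in> mahavier_inf X G" "y \<in> mahavier_inf X G" "?code x = ?code y"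
    have "x i \<in> ?V" using walk_in_Field[OF w[OF xy(1), of "Suc i"]] by simp
    then have "visit_span {t\<in>UNIV. x t = x i} = visit_span {t\<in>UNIV. y t = x i}"
      using fun_cong[OF xy(3), of "x i"] by simp
    then show "x i = y i"
      using visit_spans_determine_walk[OF assms(1), of UNIV x y i] w xy by simp
  qed
  moreover have "?code ` mahavier_inf X G \<subseteq> PiE ?V (\<lambda>_. UNIV)" by auto
  moreover have "countable (PiE ?V (\<lambda>_. UNIV :: (nat \<times> nat option) option set))"
    using assms(2) by (intro countable_PiE finite_Field) auto
  ultimately show ?thesis by (meson countable_image_inj_on countable_subset)
qed

text \<open>The span of a set of times in \<open>{..m}\<close> is either \<open>None\<close> or given by a pair of times, so it has at most
  \<open>(m + 1)\<^sup>2 + 1\<close> values for each vertex.\<close>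

lemma polynomially_many_walks:
  assumes "\<not> diverging_loops G" "finite G"
  shows "card (mahavier (Field G) G m) \<le> ((m + 1)\<^sup>2 + 1) ^ card (Field G)"
proof -
  let ?V = "Field G"
  let ?C = "insert None ((\<lambda>(a, b). Some (a, Some b)) ` ({..m} \<times> {..m}))"
  let ?code = "\<lambda>xs. \<lambda>v\<in>?V. visit_span {t\<in>{..m}. xs ! t = v}"
  have "inj_on ?code (mahavier ?V G m)"
  proof (rule inj_onI)
    fix x y assume xy: "x \<in> mahavier ?V G m" "y \<in> mahavier ?V G m" "?code x = ?code y"
    show "x = y"
    proof (rule nth_equalityI)
      show len: "length x = length y" using xy by (simp add: mahavier_iff_walk)
      fix i assume i: "i < length x"
      then have im: "i \<le> m" using xy by (simp add: mahavier_iff_walk)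
      have "x ! i \<in> ?V" using i xy by (auto simp: mahavier_iff_walk)
      then have "visit_span {t\<in>{..m}. x ! t = x ! i} = visit_span {t\<in>{..m}. y ! t = x ! i}"
        using fun_cong[OF xy(3), of "x ! i"] by simp
      then show "x ! i = y ! i"
        using visit_spans_determine_walk[OF assms(1), of "{..m}" "(!) x" "(!) y" i] im xy walk_mono
        by (auto simp: mahavier_iff_walk)
    qed
  qed
  moreover have "?code ` mahavier ?V G m \<subseteq> PiE ?V (\<lambda>_. ?C)"
  proof -
    have "visit_span S \<in> ?C" if "S \<subseteq> {..m}" for S
    proof (cases "S = {}")
      case False
      moreover have "finite S" using that finite_subset by blast
      moreover have "Inf S \<in> S" "Max S \<in> S" using False \<open>finite S\<close> Inf_nat_def1 by auto
      ultimately have "visit_span S = Some (Inf S, Some (Max S))" "Inf S \<le> m" "Max S \<le> m"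
        using that by (auto simp: visit_span_def)
      then show ?thesis by force
    qed (simp add: visit_span_def)
    moreover have "{t\<in>{..m}. xs ! t = v} \<subseteq> {..m}" for xs :: "'a list" and v by blast
    ultimately have "visit_span {t\<in>{..m}. xs ! t = v} \<in> ?C" for xs :: "'a list" and v by blast
    then show ?thesis by (intro image_subsetI restrict_PiE_iff[THEN iffD2] ballI)
  qed
  moreover have fin: "finite ?V" using assms(2) by (rule finite_Field)
  moreover have "finite (PiE ?V (\<lambda>_. ?C))" using fin by (intro finite_PiE) auto
  ultimately have "card (mahavier ?V G m) \<le> card (PiE ?V (\<lambda>_. ?C))"
    by (intro card_inj_on_le)
  also have "\<dots> = card ?C ^ card ?V" using fin by (simp add: card_PiE)
  also have "\<dots> \<le> ((m + 1)\<^sup>2 + 1) ^ card ?V"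
  proof (rule power_mono)
    have "card ?C \<le> Suc (card ((\<lambda>(a, b). Some (a, Some b)) ` ({..m} \<times> {..m})))"
      by (rule card_insert_le_m1) auto
    also have "\<dots> \<le> Suc (card ({..m} \<times> {..m}))"
      by (intro Suc_leI le_imp_less_Suc card_image_le) auto
    finally show "card ?C \<le> (m + 1)\<^sup>2 + 1" by (simp add: power2_eq_square)
  qed simp
  finally show ?thesis .
qed

section \<open>Subadditivity of the number of walks\<close>

text \<open>Fekete's lemma. The limit is the infimum \<open>l\<close> of the quotients: if \<open>u n / n\<close> is close to \<open>l\<close>, division of
  \<open>m\<close> by \<open>n\<close> with remainder gives \<open>u m \<le> (m div n) * u n + C\<close> with \<open>C\<close> independent of \<open>m\<close>.\<close>

lemma subadditive_quotient_convergent: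
  fixes u :: "nat \<Rightarrow> real"
  assumes sub: "\<And>m n. u (m + n) \<le> u m + u n" and nn: "\<And>n. 0 \<le> u n"
  shows "convergent (\<lambda>n. u n / real n)"
proof -
  define l where "l = (INF n\<in>{1..}. u n / real n)"
  have bdd: "bdd_below ((\<lambda>n. u n / real n) ` {1..})"
    using nn by (intro bdd_belowI[of _ 0]) auto
  have mult: "u (q * n) \<le> real q * u n + u 0" for q n
  proof (induction q)
    case (Suc q)
    have "u (Suc q * n) \<le> u n + u (q * n)" using sub[of n "q * n"] by simp
    with Suc show ?case by (simp add: algebra_simps)
  qed simp
  have "(\<lambda>n. u n / real n) \<longlonglongrightarrow> l"
  proof (rule order_tendstoI)
    fix a assume a: "a < l"
    have "a < u n / real n" if "n \<ge> 1" for n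
      using a cINF_lower[OF bdd, of n] that unfolding l_def by simp
    then show "\<forall>\<^sub>F n in sequentially. a < u n / real n"
      unfolding eventually_sequentially by blast
  next
    fix a assume "l < a"
    then obtain n where n: "n \<ge> 1" "u n / real n < a"
      unfolding l_def using cINF_less_iff[OF _ bdd, of a] by auto
    \<comment> \<open>The sum bounds \<open>u r\<close> for every remainder \<open>r < n\<close>; the term \<open>u 0\<close> is the one left over in \<open>mult\<close>.\<close>
    define C where "C = u 0 + (\<Sum>r<n. u r)"
    have le: "u m / real m \<le> u n / real n + C / real m" if "m \<ge> 1" for m
    proof -
      have "u m \<le> u (m div n * n) + u (m mod n)" using sub[of "m div n * n" "m mod n"] by simp
      also have "u (m mod n) \<le> (\<Sum>r<n. u r)"
        using n nn by (intro member_le_sum) auto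
      also have "u (m div n * n) \<le> real (m div n) * u n + u 0" by (rule mult)
      finally have "u m \<le> real (m div n) * u n + C" by (simp add: C_def)
      also have "real (m div n) * u n \<le> (real m / real n) * u n"
        using nn by (intro mult_right_mono of_nat_div_le_of_nat) auto
      finally show ?thesis using that n by (simp add: field_simps)
    qed
    have "(\<lambda>m. u n / real n + C / real m) \<longlonglongrightarrow> u n / real n + 0"
      by (intro tendsto_intros lim_const_over_n)
    then have "\<forall>\<^sub>F m in sequentially. u n / real n + C / real m < a"
      using n(2) by (intro order_tendstoD(2)[of _ "u n / real n"]) auto
    then show "\<forall>\<^sub>F m in sequentially. u m / real m < a"
      using eventually_ge_at_top[of 1] by eventually_elim (use le in fastforce)
  qed
  then show ?thesis by (rule convergentI)
qed

text \<open>Cutting a walk after \<open>m\<close> steps is injective. The two parts share the vertex at time \<open>m\<close>,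
  whence \<open>Suc m\<close> in \<open>take\<close> and \<open>m\<close> in \<open>drop\<close>.\<close>

lemma card_mahavier_add_le:
  assumes "finite X"
  shows "card (mahavier X G (m + n)) \<le> card (mahavier X G m) * card (mahavier X G n)"
proof -
  let ?f = "\<lambda>xs. (take (Suc m) xs, drop m xs)"
  have "?f ` mahavier X G (m + n) \<subseteq> mahavier X G m \<times> mahavier X G n"
  proof
    fix z assume "z \<in> ?f ` mahavier X G (m + n)"
    then obtain xs where xs: "z = ?f xs" "length xs = Suc (m + n)" "set xs \<subseteq> X"
      "walk G ((!) xs) (m + n)" by (auto simp: mahavier_iff_walk)
    have "walk G ((!) (take (Suc m) xs)) m" "walk G ((!) (drop m xs)) n"
      using xs by (auto simp: walk_def)
    then show "z \<in> mahavier X G m \<times> mahavier X G n"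
      using xs set_take_subset[of "Suc m" xs] set_drop_subset[of m xs]
      by (auto simp: mahavier_iff_walk simp del: take_Suc)
  qed
  moreover have "inj_on ?f (mahavier X G (m + n))"
  proof (rule inj_onI)
    fix x y :: "'a list" assume "?f x = ?f y"
    then have "take (Suc m) x = take (Suc m) y" "drop m x = drop m y" by auto
    moreover from this have "take m (take (Suc m) x) = take m (take (Suc m) y)" by simp
    then have "take m x = take m y" by (simp only: take_take) simp
    ultimately show "x = y" by (metis append_take_drop_id)
  qed
  ultimately have "card (mahavier X G (m + n)) \<le> card (mahavier X G m \<times> mahavier X G n)"
    using assms by (intro card_inj_on_le) (auto simp: finite_mahavier)
  then show ?thesis by (simp add: card_cartesian_product)
qed

section \<open>Cover numbers and entropy\<close>

lemma mem_listset_iff: "xs \<in> listset Ss \<longleftrightarrow> list_all2 (\<in>) xs Ss"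
  by (induction Ss arbitrary: xs) (auto simp: set_Cons_def list_all2_Cons2)

lemma cover_number_le:
  assumes "\<V> \<subseteq> \<U>" "\<V> \<noteq> {}" "finite \<V>" "K \<subseteq> \<Union>\<V>"
  shows "cover_number K \<U> \<le> card \<V>"
  unfolding cover_number_def using assms by (intro Least_le) blast

lemma cover_number_attained:
  assumes "\<V> \<subseteq> \<U>" "\<V> \<noteq> {}" "finite \<V>" "K \<subseteq> \<Union>\<V>"
  obtains \<W> where "\<W> \<subseteq> \<U>" "\<W> \<noteq> {}" "finite \<W>" "K \<subseteq> \<Union>\<W>" "card \<W> = cover_number K \<U>"
proof -
  have "\<exists>\<W>. \<W> \<subseteq> \<U> \<and> \<W> \<noteq> {} \<and> finite \<W> \<and> K \<subseteq> \<Union>\<W> \<and> card \<W> = cover_number K \<U>"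
    unfolding cover_number_def by (rule LeastI[of _ "card \<V>"]) (use assms in blast)
  then show ?thesis using that by blast
qed

text \<open>Choose for every point of \<open>X\<close> a member of the cover that contains it; every element of \<open>K\<close> then lies in
  the product of the members chosen for its entries.\<close>

lemma cover_power_finite_subcover:
  assumes "open_cover X \<alpha>" "finite K" "\<And>xs. xs \<in> K \<Longrightarrow> length xs = n \<and> set xs \<subseteq> X"
  obtains \<V> where "\<V> \<subseteq> cover_power \<alpha> n" "\<V> \<noteq> {}" "finite \<V>" "K \<subseteq> \<Union>\<V>" "card \<V> \<le> max 1 (card K)"
proof (cases "K = {}")
  case True
  obtain S where "S \<in> \<alpha>" using assms(1) by (auto simp: open_cover_def)
  then have "listset (replicate n S) \<in> cover_power \<alpha> n" by (auto simp: cover_power_def)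
  then show ?thesis using that[of "{listset (replicate n S)}"] True by auto
next
  case False
  have "\<forall>x\<in>X. \<exists>S\<in>\<alpha>. x \<in> S" using assms(1) by (auto simp: open_cover_def)
  then obtain f where f: "\<And>x. x \<in> X \<Longrightarrow> f x \<in> \<alpha> \<and> x \<in> f x" by metis
  let ?V = "(\<lambda>xs. listset (map f xs)) ` K"
  show ?thesis
  proof (rule that[of ?V])
    show "?V \<subseteq> cover_power \<alpha> n" using assms(3) f by (fastforce simp: cover_power_def)
    show "K \<subseteq> \<Union>?V"
    proof
      fix xs assume "xs \<in> K"
      then have "list_all2 (\<in>) xs (map f xs)"
        using assms(3) f by (auto simp: list_all2_conv_all_nth subset_iff)
      then show "xs \<in> \<Union>?V" using \<open>xs \<in> K\<close> mem_listset_iff by blast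
    qed
    show "card ?V \<le> max 1 (card K)" 
      using card_image_le[OF assms(2), of "\<lambda>xs. listset (map f xs)"] by (simp add: le_max_iff_disj)
  qed (use False assms(2) in auto)
qed

text \<open>A walk with at least one step runs through vertices only. For \<open>m = 0\<close> this fails: \<open>mahavier X G 0\<close> consists of
  the one-element lists over \<open>X\<close>, possibly infinitely many.\<close>

lemma mahavier_eq_mahavier_Field:
  assumes "Field G \<subseteq> X" "0 < m"
  shows "mahavier X G m = mahavier (Field G) G m"
proof -
  have "set xs \<subseteq> Field G" if "length xs = Suc m" "walk G ((!) xs) m" for xs
    using walk_in_Field[OF that(2) assms(2)] that(1) by (auto simp: in_set_conv_nth less_Suc_eq_le)
  then show ?thesis using assms(1) unfolding mahavier_iff_walk set_eq_iff by blast
qed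

lemma cover_number_walks_bounds:
  assumes "open_cover X \<alpha>" "finite G" "Field G \<subseteq> X" "0 < m"
  defines "N \<equiv> cover_number (mahavier X G m) (cover_power \<alpha> (m + 1))"
  shows "1 \<le> N" "N \<le> max 1 (card (mahavier (Field G) G m))"
proof -
  have "finite (mahavier X G m)"
    using assms(2) by (simp add: mahavier_eq_mahavier_Field[OF assms(3,4)] finite_mahavier finite_Field)
  then obtain \<V> where V: "\<V> \<subseteq> cover_power \<alpha> (m + 1)" "\<V> \<noteq> {}" "finite \<V>"
    "mahavier X G m \<subseteq> \<Union>\<V>" "card \<V> \<le> max 1 (card (mahavier X G m))"
    using cover_power_finite_subcover[OF assms(1), of "mahavier X G m" "m + 1"]
    by (auto simp: mahavier_iff_walk)
  show "N \<le> max 1 (card (mahavier (Field G) G m))"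
    using cover_number_le[OF V(1-4)] V(5) by (simp add: N_def mahavier_eq_mahavier_Field[OF assms(3,4)])
  obtain \<W> where "\<W> \<subseteq> cover_power \<alpha> (m + 1)" "\<W> \<noteq> {}" "finite \<W>"
    "mahavier X G m \<subseteq> \<Union>\<W>" "card \<W> = N"
    by (rule cover_number_attained[OF V(1-4), folded N_def])
  then have "N > 0" using card_gt_0_iff by metis
  then show "1 \<le> N" by simp
qed

lemma no_diverging_loops_imp_ent_cover_zero:
  assumes "\<not> diverging_loops G" "finite G" "Field G \<subseteq> X" "open_cover X \<alpha>"
  shows "ent_cover X G \<alpha> = 0"
proof -
  let ?N = "\<lambda>m. cover_number (mahavier X G m) (cover_power \<alpha> (m + 1))"
  let ?d = "card (Field G)"
  have "(\<lambda>m. ln (real (?N m)) / real m) \<longlonglongrightarrow> 0"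
  proof (rule tendsto_sandwich)
    show "\<forall>\<^sub>F m in sequentially. 0 \<le> ln (real (?N m)) / real m"
      using eventually_gt_at_top[of 0]
    proof eventually_elim
      case (elim m)
      then show ?case using cover_number_walks_bounds(1)[OF assms(4,2,3)] by simp
    qed
    show "\<forall>\<^sub>F m in sequentially. ln (real (?N m)) / real m \<le> real ?d * ln ((real m + 1)\<^sup>2 + 1) / real m"
      using eventually_gt_at_top[of 0]
    proof eventually_elim
      case (elim m)
      let ?b = "(m + 1)\<^sup>2 + 1"
      have N: "1 \<le> ?N m" "?N m \<le> max 1 (card (mahavier (Field G) G m))"
        using cover_number_walks_bounds[OF assms(4,2,3) elim] by auto
      have "card (mahavier (Field G) G m) \<le> ?b ^ ?d"
        by (rule polynomially_many_walks[OF assms(1,2)])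
      moreover have "1 \<le> ?b ^ ?d" by simp
      ultimately have "?N m \<le> ?b ^ ?d" using N(2) by linarith
      then have "real (?N m) \<le> real (?b ^ ?d)" by (rule of_nat_mono)
      then have "ln (real (?N m)) \<le> ln (real (?b ^ ?d))" using N(1) by (intro ln_mono) auto
      also have "\<dots> = real ?d * ln (real ?b)" by (simp only: of_nat_power ln_realpow)
      also have "real ?b = (real m + 1)\<^sup>2 + 1" by simp
      finally show ?case using elim by (simp add: divide_right_mono)
    qed
    show "(\<lambda>m. real ?d * ln ((real m + 1)\<^sup>2 + 1) / real m) \<longlonglongrightarrow> 0" by real_asymp
  qed simp
  then show ?thesis unfolding ent_cover_def by (rule limI)
qed

lemma no_diverging_loops_imp_ent_zero:
  assumes "\<not> diverging_loops G" "finite G" "Field G \<subseteq> X"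
  shows "ent X G = 0"
proof -
  have "open_cover X {X}" by (auto simp: open_cover_def)
  then have "{\<alpha>. open_cover X \<alpha>} \<noteq> {}" by blast
  moreover have "ereal (ent_cover X G \<alpha>) = 0" if "\<alpha> \<in> {\<alpha>. open_cover X \<alpha>}" for \<alpha>
    using no_diverging_loops_imp_ent_cover_zero[OF assms] that by (simp add: zero_ereal_def)
  ultimately show ?thesis unfolding ent_def by (simp add: SUP_eq_const)
qed

text \<open>Each member contains exactly one point of \<open>V\<close> if \<open>V \<subseteq> X\<close>. Removing the other points of \<open>V\<close>, instead of
  taking small balls, makes the members cover \<open>X\<close>, if \<open>V \<noteq> {}\<close>, without further sets.\<close>

definition vertex_cover :: "'a set \<Rightarrow> 'a set \<Rightarrow> 'a set set" where
  "vertex_cover X V = (\<lambda>v. X - (V - {v})) ` V"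

lemma open_cover_vertex_cover:
  fixes X :: "'a::t1_space set"
  assumes "finite V" "V \<noteq> {}"
  shows "open_cover X (vertex_cover X V)"
proof -
  have "openin (top_of_set X) (X - (V - {v}))" for v
  proof -
    have "open (- (V - {v}))" using assms(1) by (intro open_Compl finite_imp_closed) auto
    moreover have "X - (V - {v}) = X \<inter> - (V - {v})" by auto
    ultimately show ?thesis by (metis openin_open_Int)
  qed
  then show ?thesis using assms(2) by (auto simp: open_cover_def vertex_cover_def)
qed

text \<open>A product of members of the cover contains only one sequence of vertices, so different walks
  need different elements of the subfamily.\<close>

lemma cover_number_vertex_cover:
  fixes X :: "'a::t1_space set"
  assumes "finite G" "Field G \<subseteq> X" "0 < m" "mahavier (Field G) G m \<noteq> {}"
  shows "cover_number (mahavier X G m) (cover_power (vertex_cover X (Field G)) (m + 1))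
           = card (mahavier (Field G) G m)"
proof -
  let ?V = "Field G" and ?U = "cover_power (vertex_cover X (Field G)) (m + 1)"
  let ?K = "mahavier ?V G m"
  have KX: "mahavier X G m = ?K" by (rule mahavier_eq_mahavier_Field[OF assms(2,3)])
  have fin: "finite ?V" "finite ?K" using assms by (auto simp: finite_Field finite_mahavier)
  have ne: "?V \<noteq> {}"
  proof
    assume "?V = {}"
    with assms(4) show False by (auto simp: mahavier_iff_walk)
  qed
  have oc: "open_cover X (vertex_cover X ?V)" by (rule open_cover_vertex_cover[OF fin(1) ne])
  have K: "length xs = m + 1 \<and> set xs \<subseteq> X" if "xs \<in> ?K" for xs
    using that assms(2) by (auto simp: mahavier_iff_walk)
  obtain \<V> where V: "\<V> \<subseteq> ?U" "\<V> \<noteq> {}" "finite \<V>" "?K \<subseteq> \<Union>\<V>"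
    by (rule cover_power_finite_subcover[OF oc fin(2) K])
  obtain \<W> where W: "\<W> \<subseteq> ?U" "\<W> \<noteq> {}" "finite \<W>" "?K \<subseteq> \<Union>\<W>" "card \<W> = cover_number ?K ?U"
    by (rule cover_number_attained[OF V])
  have "\<forall>xs\<in>?K. \<exists>S. S \<in> \<W> \<and> xs \<in> S"
    using W(4) by (auto dest: subsetD)
  from bchoice[OF this] obtain f where f: "\<And>xs. xs \<in> ?K \<Longrightarrow> f xs \<in> \<W> \<and> xs \<in> f xs"
    by auto
  have "inj_on f ?K"
  proof (rule inj_onI)
    fix x y assume xy: "x \<in> ?K" "y \<in> ?K" "f x = f y"
    obtain Ss where Ss: "f x = listset Ss" "set Ss \<subseteq> vertex_cover X ?V"
      using f[OF xy(1)] W(1) by (auto simp: cover_power_def)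
    have l2: "list_all2 (\<in>) x Ss" "list_all2 (\<in>) y Ss"
      using f[OF xy(1)] f[OF xy(2)] xy(3) Ss(1) by (auto simp: mem_listset_iff)
    show "x = y"
    proof (rule nth_equalityI)
      show "length x = length y" using l2 by (metis list_all2_lengthD)
      fix i assume i: "i < length x"
      then have "x ! i \<in> Ss ! i" "y ! i \<in> Ss ! i" "Ss ! i \<in> set Ss"
        using l2 by (auto simp: list_all2_conv_all_nth)
      moreover have "x ! i \<in> ?V" "y ! i \<in> ?V"
        using i xy l2 by (auto simp: mahavier_iff_walk)
      ultimately show "x ! i = y ! i" using Ss(2) by (auto simp: vertex_cover_def)
    qed
  qed
  moreover have "f ` ?K \<subseteq> \<W>" using f by auto
  ultimately have "card ?K \<le> cover_number ?K ?U" using card_inj_on_le[OF _ _ W(3), of f ?K] W(5) by simp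
  moreover have "cover_number ?K ?U \<le> max 1 (card ?K)"
    using cover_number_walks_bounds(2)[OF oc assms(1-3)] KX by simp
  moreover have "1 \<le> card ?K" using fin(2) assms(4) by (simp add: Suc_leI card_gt_0_iff)
  ultimately show ?thesis using KX by simp
qed

text \<open>The limit for the cover by neighbourhoods of single vertices is the growth rate of the number
  of walks, and along the multiples of \<open>L\<close> that number is at least \<open>2 ^ n\<close>.\<close>

lemma diverging_loops_imp_ent_pos:
  fixes X :: "'a::t1_space set"
  assumes "diverging_loops G" "finite G" "Field G \<subseteq> X"
  shows "ent X G > 0"
proof -
  let ?V = "Field G"
  define c where "c m = card (mahavier ?V G m)" for m
  obtain u v L j where uv: "walk G u L" "walk G v L" "u L = u 0" "v 0 = u 0" "v L = u 0"
    "0 < j" "j < L" "u j \<noteq> v j"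
    using diverging_loops_equal_length[OF assms(1)] .
  have L: "L > 0" using uv by simp
  have fin: "finite ?V" using assms(2) by (rule finite_Field)
  have "?V \<noteq> {}" using walk_in_Field[OF uv(1) L, of 0] by auto
  have ne: "mahavier ?V G m \<noteq> {}" for m
  proof (cases "m = 0")
    case True
    obtain x where "x \<in> ?V" using \<open>?V \<noteq> {}\<close> by blast
    then have "[x] \<in> mahavier ?V G m" using True by (simp add: mahavier_iff_walk walk_def)
    then show ?thesis by blast
  next
    case False
    then show ?thesis
      using walk_to_list[OF walk_splice_loops[OF uv(1-5) L, of "\<lambda>_. True" m], of ?V] by auto
  qed
  have c1: "1 \<le> c m" for m
    using ne fin by (simp add: c_def Suc_leI card_gt_0_iff finite_mahavier)
  have "convergent (\<lambda>m. ln (real (c m)) / real m)"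
  proof (rule subadditive_quotient_convergent)
    fix m n
    have "real (c (m + n)) \<le> real (c m) * real (c n)"
      unfolding c_def of_nat_mult[symmetric] by (rule of_nat_mono[OF card_mahavier_add_le[OF fin]])
    then have "ln (real (c (m + n))) \<le> ln (real (c m) * real (c n))"
      using c1[of "m + n"] by (intro ln_mono) auto
    also have "\<dots> = ln (real (c m)) + ln (real (c n))"
      using c1[of m] c1[of n] by (intro ln_mult_pos) auto
    finally show "ln (real (c (m + n))) \<le> ln (real (c m)) + ln (real (c n))" .
  qed (use c1 in simp)
  then obtain l where l: "(\<lambda>m. ln (real (c m)) / real m) \<longlonglongrightarrow> l" by (auto simp: convergent_def)
  have "ln 2 / real L \<le> l"
  proof (rule LIMSEQ_le_const)
    have "strict_mono (\<lambda>n. n * L)" using L by (simp add: strict_mono_def)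
    from LIMSEQ_subseq_LIMSEQ[OF l this]
    show "(\<lambda>n. ln (real (c (n * L))) / real (n * L)) \<longlonglongrightarrow> l" by (simp add: o_def)
    have "ln 2 / real L \<le> ln (real (c (n * L))) / real (n * L)" if "n \<ge> 1" for n
    proof -
      have "2 ^ n \<le> c (n * L)"
        unfolding c_def using exponentially_many_walks[OF assms(2) uv(1-5,7,8)] that by simp
      then have "(2::real) ^ n \<le> real (c (n * L))"
        by (metis of_nat_mono of_nat_numeral of_nat_power)
      then have "ln ((2::real) ^ n) \<le> ln (real (c (n * L)))" by (intro ln_mono) auto
      then have "real n * ln 2 \<le> ln (real (c (n * L)))" by (simp add: ln_realpow)
      then show ?thesis using that L by (simp add: field_simps)
    qed
    then show "\<exists>N. \<forall>n\<ge>N. ln 2 / real L \<le> ln (real (c (n * L))) / real (n * L)" by blast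
  qed
  moreover have "ln 2 / real L > 0" using L by simp
  ultimately have "l > 0" by linarith
  have "(\<lambda>m. ln (real (cover_number (mahavier X G m) (cover_power (vertex_cover X ?V) (m + 1)))) / real m)
      \<longlonglongrightarrow> l"
  proof (rule Lim_transform_eventually[OF l])
    show "\<forall>\<^sub>F m in sequentially. ln (real (c m)) / real m =
       ln (real (cover_number (mahavier X G m) (cover_power (vertex_cover X ?V) (m + 1)))) / real m"
      using eventually_gt_at_top[of 0]
      by eventually_elim (simp add: c_def cover_number_vertex_cover[OF assms(2,3) _ ne, simplified])
  qed
  then have "ent_cover X G (vertex_cover X ?V) = l" unfolding ent_cover_def by (rule limI)
  then have "ereal l \<le> ent X G" unfolding ent_def
    using open_cover_vertex_cover[OF fin \<open>?V \<noteq> {}\<close>, of X] by (metis SUP_upper mem_Collect_eq)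
  then show ?thesis using \<open>l > 0\<close> by (metis ereal_less(2) less_le_trans)
qed

theorem theorem5p7:
  fixes X :: "'a::metric_space set" and G :: "('a \<times> 'a) set"
  assumes "compact X"
    and "finite G" and "G \<subseteq> X \<times> X"
    and "fst ` G \<subseteq> snd ` G"
  defines "P1 \<equiv> ent X G \<noteq> 0"
    and "P2 \<equiv> \<exists>A k \<epsilon>. A \<subseteq> X \<and> k \<ge> 2 \<and> \<epsilon> > 0 \<and> has_return X G k \<epsilon> A"
    and "P3 \<equiv> \<exists>kx ky. kx > 1 \<and> ky > 1 \<and>
               (\<exists>x\<in>mahavier X G (kx - 1). \<exists>y\<in>mahavier X G (ky - 1).
                  coord kx x = coord 1 x \<and> coord 1 x = coord 1 y \<and> coord 1 y = coord ky y \<and>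
                  (\<exists>j. 1 < j \<and> j \<le> min kx ky \<and> coord j x \<noteq> coord j y))"
    and "P4 \<equiv> uncountable (mahavier_inf X G)"
  shows "(P1 \<longleftrightarrow> P2) \<and> (P2 \<longleftrightarrow> P3) \<and> (P3 \<longleftrightarrow> P4)"
proof -
  have F: "Field G \<subseteq> X" using assms(3) by (auto simp: Field_def)
  have "P3 \<longleftrightarrow> diverging_loops G"
    unfolding P3_def diverging_loops_iff_mahavier[OF F] ..
  moreover have "P1 \<longleftrightarrow> diverging_loops G"
    unfolding P1_def
    using no_diverging_loops_imp_ent_zero[OF _ assms(2) F]
      diverging_loops_imp_ent_pos[OF _ assms(2) F] by fastforce
  moreover have "P2 \<longleftrightarrow> diverging_loops G"
    unfolding P2_def
    using has_return_imp_diverging_loops[OF _ _ assms(2) F]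
      diverging_loops_imp_has_return[OF _ F] by blast
  moreover have "P4 \<longleftrightarrow> diverging_loops G"
    unfolding P4_def
    using no_diverging_loops_imp_countable[OF _ assms(2), of X] diverging_loops_imp_uncountable[OF _ F]
    by blast
  ultimately show ?thesis by blast
qed

end
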